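(* Let $X$ be a non-empty $H$-closed lower regularly ordered topological pospace and let $L$ be a maximal $MCC_d$-chain in $X$. Then $L$ contains a maximal element of $L$.
   Context: All topological spaces are Hausdorff. A topological pospace is a topological space $X$ equipped with a continuous (closed) partial order $\leqslant$, i.e. one whose graph is closed in $X\times X$. A topological pospace $X$ is $H$-closed if $X$ is a closed subspace of every Hausdorff topological pospace in which it is contained (as a subspace with the induced order). A chain is a subset linearly ordered by the partial order; a maximal chain is a chain properly contained in no other chain. For $A\subseteq X$, ${\uparrow}A=\{y\in X\mid x\leqslant y\text{ for some }x\in A\}$ and ${\downarrow}A=\{y\in X\mid y\leqslant x\text{ for some }x\in A\}$; $A$ is increasing if $A={\uparrow}A$ and decreasing if $A={\downarrow}A$. An $MCC_d$-chain in $X$ is a maximal chain $L$ of $X$ such that ${\downarrow}L$ is closed in $X$ (so "maximal $MCC_d$-chain" means the same as $MCC_d$-chain). A topological pospace $X$ is lower regularly ordered if for each closed decreasing subset $F$ of $X$ and each $a\notin F$ there exist disjoint open neighbourhoods $U$ of $a$ and $V$ of $F$ such that $U$ is increasing and $V$ is decreasing in $X$. An element $y$ of a partially ordered set $A$ is maximal in $A$ if $y\leqslant x$ with $x\in A$ implies $x\leqslant y$. *)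

theory Defs
  imports "HOL-Analysis.Analysis"
begin

text \<open>An order on a space is given by its graph \<open>r\<close>, with \<open>(x, y) \<in> r\<close> read as \<open>x \<le> y\<close>.\<close>

definition topological_pospace :: "'a topology \<Rightarrow> 'a rel \<Rightarrow> bool" where
  "topological_pospace X r \<longleftrightarrow>
     Hausdorff_space X \<and> partial_order_on (topspace X) r \<and> closedin (prod_topology X X) r"

definition up_set :: "'a rel \<Rightarrow> 'a set \<Rightarrow> 'a set" where
  "up_set r A = {y. \<exists>x\<in>A. (x, y) \<in> r}"

definition down_set :: "'a rel \<Rightarrow> 'a set \<Rightarrow> 'a set" where
  "down_set r A = {y. \<exists>x\<in>A. (y, x) \<in> r}"

definition increasing_set :: "'a rel \<Rightarrow> 'a set \<Rightarrow> bool" where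
  "increasing_set r A \<longleftrightarrow> A = up_set r A"

definition decreasing_set :: "'a rel \<Rightarrow> 'a set \<Rightarrow> bool" where
  "decreasing_set r A \<longleftrightarrow> A = down_set r A"

definition pospace_embedding ::
    "'a topology \<Rightarrow> 'a rel \<Rightarrow> 'b topology \<Rightarrow> 'b rel \<Rightarrow> ('a \<Rightarrow> 'b) \<Rightarrow> bool" where
  "pospace_embedding X r Y s f \<longleftrightarrow>
     embedding_map X Y f \<and>
     (\<forall>x\<in>topspace X. \<forall>y\<in>topspace X. (x, y) \<in> r \<longleftrightarrow> (f x, f y) \<in> s)"

text \<open>A definition cannot quantify over all types in which an ambient pospace may live. It is
  enough to consider ambient pospaces over \<^typ>\<open>'a option\<close>: if the image of \<open>X\<close> is not closed
  in an ambient pospace, then it is not closed in the subspace obtained by adding one point of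
  its closure. The lemma \<open>H_closed_pospaceD\<close> below recovers the property for ambient
  pospaces over an arbitrary type.\<close>

definition H_closed_pospace :: "'a topology \<Rightarrow> 'a rel \<Rightarrow> bool" where
  "H_closed_pospace X r \<longleftrightarrow>
     topological_pospace X r \<and>
     (\<forall>(Y :: 'a option topology) s f.
        topological_pospace Y s \<and> pospace_embedding X r Y s f \<longrightarrow> closedin Y (f ` topspace X))"

lemma H_closed_pospaceD:
  fixes X :: "'a topology" and Y :: "'b topology"
  assumes H: "H_closed_pospace X r"
    and Y: "topological_pospace Y s"
    and f: "pospace_embedding X r Y s f"
  shows "closedin Y (f ` topspace X)"
proof (rule ccontr)
  assume nc: "\<not> closedin Y (f ` topspace X)"
  have emb: "embedding_map X Y f"
    and ord: "\<And>x y. x \<in> topspace X \<Longrightarrow> y \<in> topspace X \<Longrightarrow> (x, y) \<in> r \<longleftrightarrow> (f x, f y) \<in> s"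
    using f by (auto simp: pospace_embedding_def)
  have hom: "homeomorphic_map X (subtopology Y (f ` topspace X)) f"
    using emb by (simp add: embedding_map_def)
  have cf: "continuous_map X Y f"
    using hom homeomorphic_imp_continuous_map continuous_map_in_subtopology by blast
  have inj: "inj_on f (topspace X)"
    using hom homeomorphic_imp_injective_map by blast
  have fY: "f ` topspace X \<subseteq> topspace Y"
    using cf by (simp add: continuous_map_image_subset_topspace)
  obtain p where p: "p \<in> Y closure_of (f ` topspace X)" "p \<notin> f ` topspace X"
    using nc fY closure_of_subset_eq by blast
  have pY: "p \<in> topspace Y"
    using p(1) by (simp add: in_closure_of)
  define A where "A = insert None (Some ` topspace X)"
  define g where "g z = (case z of None \<Rightarrow> p | Some x \<Rightarrow> f x)" for z
  define Z where "Z = pullback_topology A g Y"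
  define t where "t = {(a, b). a \<in> A \<and> b \<in> A \<and> (g a, g b) \<in> s}"
  have gS: "g (Some x) = f x" and gN: "g None = p" for x
    by (simp_all add: g_def)
  have tZ: "topspace Z = A"
    using fY pY by (auto simp: Z_def topspace_pullback_topology A_def gS gN)
  have cg: "continuous_map Z Y g"
    unfolding Z_def using continuous_map_pullback[of Y Y id A g] by simp
  have ig: "inj_on g A"
    using inj p(2) by (auto simp: inj_on_def A_def gS gN)
  have hausZ: "Hausdorff_space Z"
    using Y cg ig tZ Hausdorff_space_injective_preimage
    unfolding topological_pospace_def by metis
  have gin: "g a \<in> topspace Y" if "a \<in> A" for a
    using that fY pY by (auto simp: A_def gS gN)
  have po: "partial_order_on (topspace Y) s" and cs: "closedin (prod_topology Y Y) s"
    using Y by (auto simp: topological_pospace_def)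
  have poZ: "partial_order_on A t"
  proof -
    have "refl_on A t"
      using po gin by (auto simp: partial_order_on_def preorder_on_def refl_on_def t_def)
    moreover have "trans t"
      using partial_order_onD(2)[OF po] by (auto simp: t_def intro!: transI dest: transD)
    moreover have "antisym t"
      using partial_order_onD(3)[OF po] by (auto simp: t_def intro!: antisymI inj_onD[OF ig] dest: antisymD)
    ultimately show ?thesis
      by (auto simp: partial_order_on_def preorder_on_def t_def)
  qed
  have "continuous_map (prod_topology Z Z) (prod_topology Y Y) (\<lambda>z. (g (fst z), g (snd z)))"
    using continuous_map_compose[OF continuous_map_fst[of Z Z] cg]
      continuous_map_compose[OF continuous_map_snd[of Z Z] cg]
    by (simp add: continuous_map_pairwise o_def)
  from closedin_continuous_map_preimage[OF this cs]
  have "closedin (prod_topology Z Z)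
          {z \<in> topspace (prod_topology Z Z). (g (fst z), g (snd z)) \<in> s}" .
  moreover have "{z \<in> topspace (prod_topology Z Z). (g (fst z), g (snd z)) \<in> s} = t"
    by (auto simp: t_def tZ)
  ultimately have tpZ: "topological_pospace Z t"
    using hausZ poZ by (simp add: topological_pospace_def tZ)
  have cS: "continuous_map X Z Some"
    unfolding Z_def
  proof (rule continuous_map_pullback')
    show "continuous_map X Y (g \<circ> Some)"
      using cf by (simp add: o_def gS)
    show "topspace X \<subseteq> Some -` A"
      by (auto simp: A_def)
  qed
  have "open_map X (subtopology Z (Some ` topspace X)) Some"
    unfolding open_map_def
  proof (intro allI impI)
    fix U assume U: "openin X U"
    then have US: "U \<subseteq> topspace X"
      by (rule openin_subset)
    have "openin (subtopology Y (f ` topspace X)) (f ` U)"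
      using U US hom homeomorphic_map_openness by blast
    then obtain W where W: "openin Y W" "f ` U = W \<inter> f ` topspace X"
      by (auto simp: openin_subtopology)
    have "Some ` U = (g -` W \<inter> A) \<inter> Some ` topspace X"
    proof -
      have "f x \<in> W \<longleftrightarrow> x \<in> U" if "x \<in> topspace X" for x
        using W(2) that inj US unfolding inj_on_def by blast
      then show ?thesis
        using US by (auto simp: A_def gS)
    qed
    moreover have "openin Z (g -` W \<inter> A)"
      using W(1) by (auto simp: Z_def openin_pullback_topology)
    ultimately show "openin (subtopology Z (Some ` topspace X)) (Some ` U)"
      by (auto simp: openin_subtopology)
  qed
  moreover have "continuous_map X (subtopology Z (Some ` topspace X)) Some"
    using cS by (auto simp: continuous_map_in_subtopology)
  moreover have "Some ` topspace X = topspace (subtopology Z (Some ` topspace X))"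
    by (auto simp: tZ A_def)
  ultimately have "embedding_map X Z Some"
    unfolding embedding_map_def by (metis bijective_open_imp_homeomorphic_map inj_Some)
  then have "pospace_embedding X r Z t Some"
    using ord by (auto simp: pospace_embedding_def t_def A_def gS)
  then have "closedin Z (Some ` topspace X)"
    using H tpZ by (auto simp: H_closed_pospace_def)
  then have "openin Z (A - Some ` topspace X)"
    by (metis closedin_def tZ)
  then obtain U where U: "openin Y U" "A - Some ` topspace X = g -` U \<inter> A"
    by (auto simp: Z_def openin_pullback_topology)
  have "None \<in> A - Some ` topspace X"
    by (auto simp: A_def)
  then have "p \<in> U"
    using gN unfolding U(2) by simp
  then obtain x where "x \<in> topspace X" "f x \<in> U"
    using p(1) U(1) unfolding in_closure_of by blast
  then have "Some x \<in> g -` U \<inter> A"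
    by (simp add: gS A_def)
  then show False
    using U(2) \<open>x \<in> topspace X\<close> by blast
qed

definition lower_regularly_ordered :: "'a topology \<Rightarrow> 'a rel \<Rightarrow> bool" where
  "lower_regularly_ordered X r \<longleftrightarrow>
     (\<forall>F a. closedin X F \<and> decreasing_set r F \<and> a \<in> topspace X - F \<longrightarrow>
        (\<exists>U V. openin X U \<and> openin X V \<and> a \<in> U \<and> F \<subseteq> V \<and> disjnt U V \<and>
           increasing_set r U \<and> decreasing_set r V))"

text \<open>If \<open>r\<close> is a partial order on the carrier, members of \<^term>\<open>Chains r\<close> are
  automatically subsets of that carrier.\<close>

definition maximal_chain :: "'a rel \<Rightarrow> 'a set \<Rightarrow> bool" where
  "maximal_chain r L \<longleftrightarrow> L \<in> Chains r \<and> \<not> (\<exists>C\<in>Chains r. L \<subset> C)"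

definition MCC_d_chain :: "'a topology \<Rightarrow> 'a rel \<Rightarrow> 'a set \<Rightarrow> bool" where
  "MCC_d_chain X r L \<longleftrightarrow> maximal_chain r L \<and> closedin X (down_set r L)"

definition maximal_element :: "'a rel \<Rightarrow> 'a set \<Rightarrow> 'a \<Rightarrow> bool" where
  "maximal_element r A y \<longleftrightarrow> y \<in> A \<and> (\<forall>x\<in>A. (y, x) \<in> r \<longrightarrow> (x, y) \<in> r)"

end

theory Submission
  imports Defs
begin

text \<open>
  A maximal chain \<open>L\<close> without a greatest element has no upper bound at all, since an upper bound
  could be adjoined to \<open>L\<close>. The space \<open>X\<close> can then be enlarged by an ideal supremum of \<open>L\<close>: a
  new point \<open>p\<close> that lies above exactly the points of \<open>\<down>L\<close> and below no point of \<open>X\<close>. As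
  neighbourhoods of \<open>p\<close> take the sets \<open>{p} \<union> (U \<inter> V)\<close>, where \<open>U\<close> is open, increasing and meets
  \<open>L\<close>, and \<open>V\<close> is open, decreasing and contains \<open>L\<close>. An increasing set that meets the chain
  contains a tail of it, so these sets form a filter base (\<open>supremum_base_directed\<close>), and each of
  them meets \<open>L\<close>; hence \<open>p\<close> lies in the closure of \<open>X\<close>.

  Lower regularity makes the enlarged space a pospace (\<open>supremum_extension_pospace\<close>). It
  separates a point \<open>x\<close> from \<open>p\<close> in two ways. Some \<open>l \<in> L\<close> is not in the closed decreasing set
  \<open>\<down>x\<close>, and separating \<open>l\<close> from \<open>\<down>x\<close> shows that points near \<open>p\<close> are not below points near \<open>x\<close>.
  If \<open>x \<notin> \<down>L\<close>, separating \<open>x\<close> from \<open>\<down>L\<close> shows that points near \<open>x\<close> are not below points near \<open>p\<close>;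
  this second use is where \<open>\<down>L\<close> must be closed. So \<open>X\<close> is a non-closed subspace of a pospace,
  and is not \<open>H\<close>-closed.
\<close>

section \<open>Pospaces and monotone sets\<close>

lemma increasing_setD: "increasing_set r A \<Longrightarrow> x \<in> A \<Longrightarrow> (x, y) \<in> r \<Longrightarrow> y \<in> A"
  by (auto simp: increasing_set_def up_set_def)

lemma decreasing_setD: "decreasing_set r A \<Longrightarrow> y \<in> A \<Longrightarrow> (x, y) \<in> r \<Longrightarrow> x \<in> A"
  by (auto simp: decreasing_set_def down_set_def)

lemma increasing_set_Int:
  assumes "refl_on S r" "A \<subseteq> S" "increasing_set r A" "increasing_set r B"
  shows "increasing_set r (A \<inter> B)"
  using assms unfolding increasing_set_def up_set_def refl_on_def by blast

lemma decreasing_set_Int: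
  assumes "refl_on S r" "A \<subseteq> S" "decreasing_set r A" "decreasing_set r B"
  shows "decreasing_set r (A \<inter> B)"
  using assms unfolding decreasing_set_def down_set_def refl_on_def by blast

lemma decreasing_down_set:
  assumes "partial_order_on S r" "r \<subseteq> S \<times> S"
  shows "decreasing_set r (down_set r A)"
  using partial_order_onD(1,2)[OF assms(1)] assms(2)
  unfolding decreasing_set_def down_set_def refl_on_def trans_def by blast

text \<open>Closedness of the order is used in this local form, both to extract and to establish it.\<close>

lemma closedin_prod_iff:
  "closedin (prod_topology X Y) r \<longleftrightarrow>
     r \<subseteq> topspace X \<times> topspace Y \<and>
     (\<forall>x\<in>topspace X. \<forall>y\<in>topspace Y. (x, y) \<notin> r \<longrightarrow>
        (\<exists>U V. openin X U \<and> openin Y V \<and> x \<in> U \<and> y \<in> V \<and> (U \<times> V) \<inter> r = {}))"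
proof -
  have "U \<times> V \<subseteq> topspace X \<times> topspace Y - r \<longleftrightarrow> (U \<times> V) \<inter> r = {}"
    if "openin X U" "openin Y V" for U V
    using openin_subset[OF that(1)] openin_subset[OF that(2)] by blast
  then have "(\<exists>U V. openin X U \<and> openin Y V \<and> x \<in> U \<and> y \<in> V \<and>
        U \<times> V \<subseteq> topspace X \<times> topspace Y - r) \<longleftrightarrow>
      (\<exists>U V. openin X U \<and> openin Y V \<and> x \<in> U \<and> y \<in> V \<and> (U \<times> V) \<inter> r = {})" for x y
    by (intro ex_cong1) auto
  then show ?thesis
    unfolding closedin_def openin_prod_topology_alt topspace_prod_topology by auto
qed

lemma pospace_subset: "topological_pospace X r \<Longrightarrow> r \<subseteq> topspace X \<times> topspace X"
  by (simp add: topological_pospace_def closedin_prod_iff)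

lemma closedin_down_set_singleton:
  assumes "topological_pospace X r" "x \<in> topspace X"
  shows "closedin X (down_set r {x})"
proof -
  have "continuous_map X (prod_topology X X) (\<lambda>y. (y, x))"
    using assms(2) by (simp add: continuous_map_pairwise o_def)
  then have "closedin X {y \<in> topspace X. (y, x) \<in> r}"
    using assms(1) closedin_continuous_map_preimage by (fastforce simp: topological_pospace_def)
  moreover have "{y \<in> topspace X. (y, x) \<in> r} = down_set r {x}"
    using pospace_subset[OF assms(1)] by (auto simp: down_set_def)
  ultimately show ?thesis by simp
qed

lemma lower_regularly_ordered_separation:
  assumes "lower_regularly_ordered X r" "closedin X F" "decreasing_set r F"
    "a \<in> topspace X" "a \<notin> F"
  obtains U V where "openin X U" "openin X V" "a \<in> U" "F \<subseteq> V" "U \<inter> V = {}"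
    "increasing_set r U" "decreasing_set r V" "(U \<times> V) \<inter> r = {}"
proof -
  obtain U V where UV: "openin X U \<and> openin X V \<and> a \<in> U \<and> F \<subseteq> V \<and> disjnt U V \<and>
      increasing_set r U \<and> decreasing_set r V"
    using assms(1)[unfolded lower_regularly_ordered_def, rule_format, of F a] assms(2-) by blast
  moreover from UV have "(U \<times> V) \<inter> r = {}"
    using increasing_setD[of r U] by (auto simp: disjnt_iff)
  ultimately show thesis
    by (intro that[of U V]) (simp_all add: disjnt_def)
qed

lemma maximal_chain_upper_bound:
  assumes "partial_order_on S r" "maximal_chain r L" "x \<in> S" "\<forall>l\<in>L. (l, x) \<in> r"
  shows "\<exists>y\<in>L. maximal_element r L y"
proof -
  have "(x, x) \<in> r"
    using assms(1,3) partial_order_onD(1) refl_onD by metis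
  then have "insert x L \<in> Chains r"
    using assms(2,4) by (auto simp: maximal_chain_def Chains_def)
  then have "x \<in> L"
    using assms(2) unfolding maximal_chain_def by blast
  then show ?thesis
    using assms(4) by (auto simp: maximal_element_def)
qed

section \<open>Adjoining a point to a topological space\<close>

text \<open>The point \<^term>\<open>None\<close> is adjoined with the family \<open>B\<close> as the traces on \<open>X\<close> of basic
  neighbourhoods; \<open>X\<close> itself remains an open subspace.\<close>

definition adjoin_point :: "'a topology \<Rightarrow> 'a set set \<Rightarrow> 'a option topology" where
  "adjoin_point X B = topology (\<lambda>S. openin X (Some -` S) \<and>
     (None \<in> S \<longrightarrow> (\<exists>N\<in>B. N \<subseteq> Some -` S)))"

lemma openin_adjoin_point:
  assumes "\<forall>M\<in>B. \<forall>N\<in>B. \<exists>K\<in>B. K \<subseteq> M \<inter> N"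
  shows "openin (adjoin_point X B) S \<longleftrightarrow>
    openin X (Some -` S) \<and> (None \<in> S \<longrightarrow> (\<exists>N\<in>B. N \<subseteq> Some -` S))"
proof -
  let ?P = "\<lambda>S. openin X (Some -` S) \<and> (None \<in> S \<longrightarrow> (\<exists>N\<in>B. N \<subseteq> Some -` S))"
  have "?P (S \<inter> T)" if "?P S" "?P T" for S T
  proof -
    have "\<exists>K\<in>B. K \<subseteq> Some -` (S \<inter> T)" if "None \<in> S \<inter> T"
    proof -
      obtain M N where MN: "M \<in> B" "N \<in> B" "M \<subseteq> Some -` S" "N \<subseteq> Some -` T"
        using \<open>?P S\<close> \<open>?P T\<close> \<open>None \<in> S \<inter> T\<close> by blast
      then obtain K where "K \<in> B" "K \<subseteq> M \<inter> N"
        using assms by blast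
      with MN(3,4) show ?thesis
        by (intro bexI[of _ K]) auto
    qed
    then show ?thesis
      using that by (simp add: openin_Int)
  qed
  moreover have "?P (\<Union>\<K>)" if "\<forall>K\<in>\<K>. ?P K" for \<K>
  proof -
    have "openin X (\<Union>K\<in>\<K>. Some -` K)"
      using that by (intro openin_Union) auto
    moreover have "\<exists>N\<in>B. N \<subseteq> Some -` \<Union>\<K>" if "None \<in> \<Union>\<K>"
      using that \<open>\<forall>K\<in>\<K>. ?P K\<close> by (meson Sup_upper UnionE subset_trans vimage_mono)
    ultimately show ?thesis
      by (simp add: vimage_Union)
  qed
  ultimately have "istopology ?P"
    unfolding istopology_def by blast
  then show ?thesis
    unfolding adjoin_point_def by (simp add: topology_inverse')
qed

context
  fixes X :: "'a topology" and B :: "'a set set"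
  assumes directed: "\<forall>M\<in>B. \<forall>N\<in>B. \<exists>K\<in>B. K \<subseteq> M \<inter> N"
    and base_open: "\<forall>N\<in>B. openin X N"
begin

lemma openin_adjoin_point_Some: "openin X U \<Longrightarrow> openin (adjoin_point X B) (Some ` U)"
  by (auto simp: openin_adjoin_point[OF directed] inj_vimage_image_eq)

lemma openin_adjoin_point_None:
  assumes "openin X U" "N \<in> B" "N \<subseteq> U"
  shows "openin (adjoin_point X B) (insert None (Some ` U))"
proof -
  have "Some -` insert None (Some ` U) = U" by auto
  then show ?thesis
    using assms by (auto simp: openin_adjoin_point[OF directed])
qed

lemma topspace_adjoin_point:
  assumes "B \<noteq> {}"
  shows "topspace (adjoin_point X B) = insert None (Some ` topspace X)"
proof
  have "Some -` topspace (adjoin_point X B) \<subseteq> topspace X"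
    using openin_topspace[of "adjoin_point X B"]
    unfolding openin_adjoin_point[OF directed] by (blast dest: openin_subset)
  then have "x \<in> insert None (Some ` topspace X)" if "x \<in> topspace (adjoin_point X B)" for x
    using that by (cases x) auto
  then show "topspace (adjoin_point X B) \<subseteq> insert None (Some ` topspace X)"
    by blast
  obtain N where "N \<in> B" using assms by blast
  then have "openin (adjoin_point X B) (insert None (Some ` topspace X))"
    using base_open by (auto intro: openin_adjoin_point_None dest: openin_subset)
  then show "insert None (Some ` topspace X) \<subseteq> topspace (adjoin_point X B)"
    by (rule openin_subset)
qed

lemma embedding_map_adjoin_point: "embedding_map X (adjoin_point X B) Some"
proof (rule injective_open_imp_embedding_map)
  show "continuous_map X (adjoin_point X B) Some"
  proof (unfold continuous_map, intro conjI allI impI)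
    show "Some ` topspace X \<subseteq> topspace (adjoin_point X B)"
      by (rule openin_subset[OF openin_adjoin_point_Some[OF openin_topspace]])
    fix S assume "openin (adjoin_point X B) S"
    then have "openin X (Some -` S)"
      by (simp add: openin_adjoin_point[OF directed])
    moreover from this have "{x \<in> topspace X. Some x \<in> S} = Some -` S"
      using openin_subset by blast
    ultimately show "openin X {x \<in> topspace X. Some x \<in> S}"
      by simp
  qed
  show "open_map X (adjoin_point X B) Some"
    by (simp add: open_map_def openin_adjoin_point_Some)
qed simp

lemma not_closedin_adjoin_point:
  assumes "B \<noteq> {}" "{} \<notin> B"
  shows "\<not> closedin (adjoin_point X B) (Some ` topspace X)"
proof
  assume "closedin (adjoin_point X B) (Some ` topspace X)"
  moreover have "topspace (adjoin_point X B) - Some ` topspace X = {None}"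
    using topspace_adjoin_point[OF assms(1)] by auto
  ultimately have "openin (adjoin_point X B) {None}"
    by (metis closedin_def)
  then obtain N where "N \<in> B" "N \<subseteq> Some -` {None}"
    unfolding openin_adjoin_point[OF directed] by blast
  moreover from this have "N = {}" by auto
  ultimately show False
    using assms(2) by blast
qed

end

section \<open>Adjoining a supremum of a chain\<close>

text \<open>The factor \<open>U\<close> keeps a basic neighbourhood of the supremum away from the lower sets of
  individual points, the factor \<open>V\<close> keeps it close to \<open>\<down>L\<close>.\<close>

definition supremum_base :: "'a topology \<Rightarrow> 'a rel \<Rightarrow> 'a set \<Rightarrow> 'a set set" where
  "supremum_base X r L = {U \<inter> V | U V.
     openin X U \<and> increasing_set r U \<and> U \<inter> L \<noteq> {} \<and>
     openin X V \<and> decreasing_set r V \<and> L \<subseteq> V}"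

definition supremum_order :: "'a rel \<Rightarrow> 'a set \<Rightarrow> 'a option rel" where
  "supremum_order r L =
     map_prod Some Some ` r \<union> insert None (Some ` down_set r L) \<times> {None}"

lemma supremum_order_iff:
  "(Some x, Some y) \<in> supremum_order r L \<longleftrightarrow> (x, y) \<in> r"
  "(Some x, None) \<in> supremum_order r L \<longleftrightarrow> x \<in> down_set r L"
  "(None, Some y) \<notin> supremum_order r L"
  "(None, None) \<in> supremum_order r L"
  by (auto simp: supremum_order_def)

lemma supremum_baseI:
  assumes "openin X U" "increasing_set r U" "U \<inter> L \<noteq> {}"
    and "openin X V" "decreasing_set r V" "L \<subseteq> V"
  shows "U \<inter> V \<in> supremum_base X r L"
  using assms unfolding supremum_base_def by (intro CollectI exI[of _ U] exI[of _ V]) simp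

lemma supremum_baseE:
  assumes "N \<in> supremum_base X r L"
  obtains U V where "N = U \<inter> V" "openin X U" "increasing_set r U" "U \<inter> L \<noteq> {}"
    "openin X V" "decreasing_set r V" "L \<subseteq> V"
  using assms unfolding supremum_base_def by (elim CollectE exE conjE)

lemma supremum_base_open: "\<forall>N\<in>supremum_base X r L. openin X N"
  by (auto simp: supremum_base_def)

lemma empty_notin_supremum_base: "{} \<notin> supremum_base X r L"
  unfolding supremum_base_def by blast

lemma supremum_base_intros:
  assumes "L \<noteq> {}" "L \<subseteq> topspace X" "r \<subseteq> topspace X \<times> topspace X" "refl_on (topspace X) r"
  shows increasing_in_supremum_base:
      "\<And>U. openin X U \<Longrightarrow> increasing_set r U \<Longrightarrow> U \<inter> L \<noteq> {} \<Longrightarrow> U \<in> supremum_base X r L"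
    and decreasing_in_supremum_base:
      "\<And>V. openin X V \<Longrightarrow> decreasing_set r V \<Longrightarrow> L \<subseteq> V \<Longrightarrow> V \<in> supremum_base X r L"
    and supremum_base_nonempty: "supremum_base X r L \<noteq> {}"
proof -
  have up: "increasing_set r (topspace X)" and down: "decreasing_set r (topspace X)"
    using assms(3,4)
    by (auto simp: increasing_set_def up_set_def decreasing_set_def down_set_def refl_on_def)
  show "U \<in> supremum_base X r L" if "openin X U" "increasing_set r U" "U \<inter> L \<noteq> {}" for U
    using supremum_baseI[OF that openin_topspace down assms(2)] openin_subset[OF that(1)]
    by (simp add: Int_absorb2)
  show "V \<in> supremum_base X r L" if "openin X V" "decreasing_set r V" "L \<subseteq> V" for V
  proof -
    have "topspace X \<inter> L \<noteq> {}"
      using assms(1,2) by auto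
    from supremum_baseI[OF openin_topspace up this that] show ?thesis
      using openin_subset[OF that(1)] by (simp add: Int_absorb1)
  qed
  from this[OF openin_topspace down assms(2)] show "supremum_base X r L \<noteq> {}"
    by blast
qed

text \<open>Two increasing sets that meet a chain contain the larger of the two points at which they
  meet it.\<close>

lemma supremum_base_directed:
  assumes "refl_on (topspace X) r" "L \<in> Chains r"
  shows "\<forall>M\<in>supremum_base X r L. \<forall>N\<in>supremum_base X r L. \<exists>K\<in>supremum_base X r L. K \<subseteq> M \<inter> N"
proof (intro ballI)
  fix M N assume "M \<in> supremum_base X r L" "N \<in> supremum_base X r L"
  obtain U V where M: "M = U \<inter> V" and
    U: "openin X U" "increasing_set r U" "U \<inter> L \<noteq> {}" and
    V: "openin X V" "decreasing_set r V" "L \<subseteq> V"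
    using \<open>M \<in> supremum_base X r L\<close> by (rule supremum_baseE)
  obtain U' V' where N: "N = U' \<inter> V'" and
    U': "openin X U'" "increasing_set r U'" "U' \<inter> L \<noteq> {}" and
    V': "openin X V'" "decreasing_set r V'" "L \<subseteq> V'"
    using \<open>N \<in> supremum_base X r L\<close> by (rule supremum_baseE)
  obtain l l' where l: "l \<in> U" "l \<in> L" and l': "l' \<in> U'" "l' \<in> L"
    using U(3) U'(3) by blast
  have "(l, l') \<in> r \<or> (l', l) \<in> r"
    using assms(2) l(2) l'(2) by (auto simp: Chains_def)
  then have "l' \<in> U \<or> l \<in> U'"
    using increasing_setD[OF U(2) l(1)] increasing_setD[OF U'(2) l'(1)] by auto
  then have meets: "U \<inter> U' \<inter> L \<noteq> {}"
    using l l' by auto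
  have "L \<subseteq> V \<inter> V'"
    using V(3) V'(3) by blast
  from supremum_baseI[OF openin_Int[OF U(1) U'(1)]
      increasing_set_Int[OF assms(1) openin_subset[OF U(1)] U(2) U'(2)] meets
      openin_Int[OF V(1) V'(1)]
      decreasing_set_Int[OF assms(1) openin_subset[OF V(1)] V(2) V'(2)] this]
  have "(U \<inter> U') \<inter> (V \<inter> V') \<in> supremum_base X r L" .
  then show "\<exists>K\<in>supremum_base X r L. K \<subseteq> M \<inter> N"
    unfolding M N by (rule bexI[rotated]) auto
qed

lemma partial_order_on_supremum_order:
  assumes "partial_order_on S r" "r \<subseteq> S \<times> S"
  shows "partial_order_on (insert None (Some ` S)) (supremum_order r L)"
proof -
  have "trans (supremum_order r L)"
  proof (rule transI)
    fix a b c assume "(a, b) \<in> supremum_order r L" "(b, c) \<in> supremum_order r L"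
    then show "(a, c) \<in> supremum_order r L"
      using partial_order_onD(2)[OF assms(1)]
        decreasing_setD[OF decreasing_down_set[OF assms], of _ L]
      by (cases a; cases b; cases c) (auto simp: supremum_order_iff dest: transD)
  qed
  moreover have "antisym (supremum_order r L)"
  proof (rule antisymI)
    fix a b assume "(a, b) \<in> supremum_order r L" "(b, a) \<in> supremum_order r L"
    then show "a = b"
      using partial_order_onD(3)[OF assms(1)]
      by (cases a; cases b) (simp_all add: supremum_order_iff antisym_def)
  qed
  moreover have "refl_on (insert None (Some ` S)) (supremum_order r L)"
  proof (rule refl_onI)
    fix a assume "a \<in> insert None (Some ` S)"
    then show "(a, a) \<in> supremum_order r L"
      using refl_onD[OF partial_order_onD(1)[OF assms(1)]]
      by (cases a) (auto simp: supremum_order_iff)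
  qed
  moreover have "supremum_order r L \<subseteq> insert None (Some ` S) \<times> insert None (Some ` S)"
    using assms(2) by (auto simp: supremum_order_def down_set_def)
  ultimately show ?thesis
    by (simp add: partial_order_on_def preorder_on_def)
qed

text \<open>Lower regularity supplies both kinds of separation from the new point. If \<open>l \<in> L\<close> is not below
  \<open>x\<close>, let \<open>U\<close> and \<open>V\<close> be disjoint open sets, \<open>U\<close> increasing with \<open>l \<in> U\<close> and \<open>V\<close> decreasing with
  \<open>x \<in> V\<close>. Then \<open>U\<close> together with the supremum is a neighbourhood of the supremum, and no point of
  \<open>U\<close> is below a point of \<open>V\<close>: this separates \<open>x\<close> from the supremum in the Hausdorff sense and shows
  that the order is closed at pairs (supremum, \<open>x\<close>). Closedness at pairs (\<open>x\<close>, supremum) with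
  \<open>x \<notin> \<down>L\<close> comes from separating \<open>x\<close> from \<open>\<down>L\<close>.\<close>

lemma supremum_extension_pospace:
  assumes X: "topological_pospace X r" and low: "lower_regularly_ordered X r"
    and chain: "L \<in> Chains r" and nonempty: "L \<noteq> {}" and closed: "closedin X (down_set r L)"
    and unbounded: "\<And>x. x \<in> topspace X \<Longrightarrow> \<exists>l\<in>L. (l, x) \<notin> r"
  shows "topological_pospace (adjoin_point X (supremum_base X r L)) (supremum_order r L)"
proof -
  let ?B = "supremum_base X r L" and ?s = "supremum_order r L"
  let ?Y = "adjoin_point X ?B"
  have po: "partial_order_on (topspace X) r" and sub: "r \<subseteq> topspace X \<times> topspace X"
    using X pospace_subset[OF X] by (simp_all add: topological_pospace_def)
  have refl: "refl_on (topspace X) r"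
    using po by (rule partial_order_onD)
  have L: "L \<subseteq> topspace X" "L \<subseteq> down_set r L"
    using chain sub by (auto simp: Chains_def down_set_def)
  note directed = supremum_base_directed[OF refl chain]
  note openSome = openin_adjoin_point_Some[OF directed supremum_base_open]
  note openNone = openin_adjoin_point_None[OF directed supremum_base_open]
  note up = increasing_in_supremum_base[OF nonempty L(1) sub refl]
  note down = decreasing_in_supremum_base[OF nonempty L(1) sub refl]
  note top = topspace_adjoin_point[OF directed supremum_base_open
      supremum_base_nonempty[OF nonempty L(1) sub refl]]

  have below: "\<exists>U V. openin ?Y (insert None (Some ` U)) \<and> openin ?Y (Some ` V) \<and> x \<in> V \<and>
      U \<inter> V = {} \<and> (U \<times> V) \<inter> r = {}" if x: "x \<in> topspace X" for x
  proof -
    obtain l where l: "l \<in> L" "(l, x) \<notin> r"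
      using unbounded[OF x] by blast
    obtain U V where UV: "openin X U" "openin X V" "l \<in> U" "down_set r {x} \<subseteq> V" "U \<inter> V = {}"
        "increasing_set r U" "(U \<times> V) \<inter> r = {}"
    proof (rule lower_regularly_ordered_separation[OF low])
      show "closedin X (down_set r {x})"
        by (rule closedin_down_set_singleton[OF X x])
      show "decreasing_set r (down_set r {x})"
        by (rule decreasing_down_set[OF po sub])
      show "l \<in> topspace X" "l \<notin> down_set r {x}"
        using l L(1) by (auto simp: down_set_def)
    qed
    have "x \<in> V"
      using UV(4) refl_onD[OF refl x] by (auto simp: down_set_def)
    moreover have "U \<in> ?B"
      using up[OF UV(1,6)] UV(3) l(1) by blast
    ultimately show ?thesis
      using openNone[OF UV(1) _ order_refl] openSome[OF UV(2)] UV(5,7)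
      by (intro exI[of _ U] exI[of _ V]) simp
  qed

  have above: "\<exists>U V. openin ?Y (Some ` U) \<and> openin ?Y (insert None (Some ` V)) \<and> x \<in> U \<and>
      U \<inter> down_set r L = {} \<and> (U \<times> V) \<inter> r = {}"
    if x: "x \<in> topspace X" "x \<notin> down_set r L" for x
  proof -
    obtain U V where UV: "openin X U" "openin X V" "x \<in> U" "down_set r L \<subseteq> V" "U \<inter> V = {}"
        "decreasing_set r V" "(U \<times> V) \<inter> r = {}"
      using lower_regularly_ordered_separation[OF low closed decreasing_down_set[OF po sub] x] .
    have "V \<in> ?B"
      using down[OF UV(2,6)] UV(4) L(2) by blast
    moreover have "U \<inter> down_set r L = {}"
      using UV(4,5) by blast
    ultimately show ?thesis
      using openNone[OF UV(2) _ order_refl] openSome[OF UV(1)] UV(3,7)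
      by (intro exI[of _ U] exI[of _ V]) simp
  qed

  have haus: "Hausdorff_space ?Y"
    unfolding Hausdorff_space_def
  proof (intro allI impI)
    fix a b assume ab: "a \<in> topspace ?Y \<and> b \<in> topspace ?Y \<and> a \<noteq> b"
    show "\<exists>U V. openin ?Y U \<and> openin ?Y V \<and> a \<in> U \<and> b \<in> V \<and> disjnt U V"
    proof (cases a)
      case None
      then obtain y where y: "b = Some y" "y \<in> topspace X" using ab top by auto
      then obtain U V where "openin ?Y (insert None (Some ` U))" "openin ?Y (Some ` V)"
          "y \<in> V" "U \<inter> V = {}"
        using below by meson
      moreover from \<open>U \<inter> V = {}\<close> have "disjnt (insert None (Some ` U)) (Some ` V)"
        by (auto simp: disjnt_iff)
      ultimately show ?thesis
        using None y(1) by blast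
    next
      case (Some x)
      then have x: "x \<in> topspace X" using ab top by auto
      show ?thesis
      proof (cases b)
        case None
        obtain U V where "openin ?Y (insert None (Some ` U))" "openin ?Y (Some ` V)"
            "x \<in> V" "U \<inter> V = {}"
          using below[OF x] by meson
        moreover from \<open>U \<inter> V = {}\<close> have "disjnt (Some ` V) (insert None (Some ` U))"
          by (auto simp: disjnt_iff)
        ultimately show ?thesis
          using None Some by blast
      next
        case (Some y)
        then have "y \<in> topspace X" "x \<noteq> y" using ab top \<open>a = Some x\<close> by auto
        then obtain U V where UV: "openin X U" "openin X V" "x \<in> U" "y \<in> V" "disjnt U V"
          using X x unfolding topological_pospace_def Hausdorff_space_def by meson
        then have "disjnt (Some ` U) (Some ` V)"
          by (auto simp: disjnt_iff)
        then show ?thesis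
          using openSome[OF UV(1)] openSome[OF UV(2)] UV(3,4) \<open>a = Some x\<close> Some by blast
      qed
    qed
  qed

  have "closedin (prod_topology ?Y ?Y) ?s"
    unfolding closedin_prod_iff
  proof (intro conjI ballI impI)
    show "?s \<subseteq> topspace ?Y \<times> topspace ?Y"
      using sub by (auto simp: top supremum_order_def down_set_def)
    fix a b assume a: "a \<in> topspace ?Y" and b: "b \<in> topspace ?Y" and ab: "(a, b) \<notin> ?s"
    show "\<exists>U V. openin ?Y U \<and> openin ?Y V \<and> a \<in> U \<and> b \<in> V \<and> (U \<times> V) \<inter> ?s = {}"
    proof (cases a)
      case None
      then obtain y where y: "b = Some y" "y \<in> topspace X"
        using ab b top supremum_order_iff(4) by auto
      then obtain U V where UV: "openin ?Y (insert None (Some ` U))" "openin ?Y (Some ` V)"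
          "y \<in> V" "(U \<times> V) \<inter> r = {}"
        using below by meson
      have "(insert None (Some ` U) \<times> Some ` V) \<inter> ?s = {}"
        using UV(4) by (auto simp: supremum_order_iff)
      then show ?thesis
        using UV None y(1) by blast
    next
      case (Some x)
      then have x: "x \<in> topspace X" using a top by auto
      show ?thesis
      proof (cases b)
        case None
        then have "x \<notin> down_set r L"
          using ab Some by (simp add: supremum_order_iff)
        then obtain U V where UV: "openin ?Y (Some ` U)" "openin ?Y (insert None (Some ` V))"
            "x \<in> U" "U \<inter> down_set r L = {}" "(U \<times> V) \<inter> r = {}"
          using above[OF x] by meson
        have "(Some ` U \<times> insert None (Some ` V)) \<inter> ?s = {}"
          using UV(4,5) by (auto simp: supremum_order_iff)
        then show ?thesis
          using UV None Some by blast
      next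
        case (Some y)
        then have y: "y \<in> topspace X" "(x, y) \<notin> r"
          using b ab top \<open>a = Some x\<close> by (auto simp: supremum_order_iff)
        then obtain U V where UV: "openin X U" "openin X V" "x \<in> U" "y \<in> V" "(U \<times> V) \<inter> r = {}"
          using X x unfolding topological_pospace_def closedin_prod_iff by meson
        have "(Some ` U \<times> Some ` V) \<inter> ?s = {}"
          using UV(5) by (auto simp: supremum_order_iff)
        then show ?thesis
          using openSome[OF UV(1)] openSome[OF UV(2)] UV(3,4) \<open>a = Some x\<close> Some by blast
      qed
    qed
  qed
  then show ?thesis
    using haus partial_order_on_supremum_order[OF po sub]
    by (simp add: topological_pospace_def top)
qed

section \<open>Greatest elements of maximal chains\<close>

theorem corollary2p6:
  fixes X :: "'a topology" and r :: "'a rel" and L :: "'a set"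
  assumes "topological_pospace X r"
    and "topspace X \<noteq> {}"
    and "H_closed_pospace X r"
    and "lower_regularly_ordered X r"
    and "MCC_d_chain X r L"
  shows "\<exists>y\<in>L. maximal_element r L y"
proof (rule ccontr)
  assume no_max: "\<not> (\<exists>y\<in>L. maximal_element r L y)"
  let ?B = "supremum_base X r L" and ?s = "supremum_order r L"
  let ?Y = "adjoin_point X ?B"
  have po: "partial_order_on (topspace X) r" and sub: "r \<subseteq> topspace X \<times> topspace X"
    using assms(1) pospace_subset[OF assms(1)] by (simp_all add: topological_pospace_def)
  have max: "maximal_chain r L" and closed: "closedin X (down_set r L)"
    using assms(5) by (auto simp: MCC_d_chain_def)
  have chain: "L \<in> Chains r"
    using max by (simp add: maximal_chain_def)
  have unbounded: "\<exists>l\<in>L. (l, x) \<notin> r" if "x \<in> topspace X" for x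
    using maximal_chain_upper_bound[OF po max that] no_max by blast
  \<comment> \<open>Every point would be an upper bound of an empty chain.\<close>
  then have nonempty: "L \<noteq> {}"
    using assms(2) by blast
  have "L \<subseteq> topspace X"
    using chain sub by (auto simp: Chains_def)
  note refl = partial_order_onD(1)[OF po]
  note directed = supremum_base_directed[OF refl chain]
  have "\<not> closedin ?Y (Some ` topspace X)"
    by (rule not_closedin_adjoin_point[OF directed supremum_base_open
          supremum_base_nonempty[OF nonempty \<open>L \<subseteq> topspace X\<close> sub refl] empty_notin_supremum_base])
  moreover have "topological_pospace ?Y ?s"
    using supremum_extension_pospace[OF assms(1,4) chain nonempty closed unbounded] .
  moreover have "pospace_embedding X r ?Y ?s Some"
    using embedding_map_adjoin_point[OF directed supremum_base_open]
    by (simp add: pospace_embedding_def supremum_order_iff)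
  ultimately show False
    using assms(3) unfolding H_closed_pospace_def by blast
qed

end
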